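(* There is an absolute constant $k>0$ such that the following holds. Let $T:C[0,1]\to C[0,1]$ be a positive linear operator such that $T(e_0)=e_0$, $T(e_1;x)\le x$ for all $x\in[0,1]$, and $$\lim_{m\to\infty}\|T^m(e_1)\|=\lim_{m\to\infty}\|T^m(e_2)\|=0.$$ Then for all $m\in\mathbb{N}$, $x\in[0,1]$ and $f\in C[0,1]$, $$|T^m(f;x)-f(0)|\le k\,\omega_2\bigl(f,\sqrt{\lambda_m(x)}\bigr)+k\,\|f\|\,\delta_m(x),$$ where $\lambda_m(x)=\max\{T^m(e_1;x),T^m(e_2;x)\}$ and $\delta_m(x)=T^m(e_1;x)$.
   Context: $C[0,1]$ is the space of real-valued continuous functions on $[0,1]$ with the supremum norm $\|\cdot\|$. A linear operator $T:C[0,1]\to C[0,1]$ is positive if $f\ge 0$ implies $T(f)\ge 0$. $T(f;x)$ denotes the value of $T(f)$ at $x$, and $T^m$ is the $m$-fold composition (iterate) of $T$. $e_i(x)=x^i$ for $i=0,1,2$. The second modulus of smoothness of $f\in C[0,1]$ is $\omega_2(f,t)=\sup_{0<h\le t}\ \sup_{0\le x\le 1-2h}|f(x+2h)-2f(x+h)+f(x)|$ for $t\ge 0$, with the convention that a supremum over an empty set is $0$ (so only $h\le 1/2$ contributes, and $\omega_2(f,0)=0$). "Absolute constant" means independent of $T$, $m$, $x$ and $f$. *)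

theory Defs
  imports Complex_Main
begin

text \<open>
  An element of $C[0,1]$ is represented by any total function that is continuous on
  \<open>{0..1}\<close>; its values outside \<open>{0..1}\<close> are junk.  Two representatives denote the same
  element iff they agree on \<open>{0..1}\<close>, and an operator has to respect this.
\<close>

definition C01 :: "(real \<Rightarrow> real) set" where
  "C01 = {f. continuous_on {0..1} f}"

definition sup_norm :: "(real \<Rightarrow> real) \<Rightarrow> real" where
  "sup_norm f = (SUP x\<in>{0..1}. \<bar>f x\<bar>)"

definition e :: "nat \<Rightarrow> real \<Rightarrow> real" where
  "e i = (\<lambda>x. x ^ i)"

definition operator_C01 :: "((real \<Rightarrow> real) \<Rightarrow> (real \<Rightarrow> real)) \<Rightarrow> bool" where
  "operator_C01 T \<longleftrightarrow>
     (\<forall>f\<in>C01. T f \<in> C01) \<and>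
     (\<forall>f\<in>C01. \<forall>g\<in>C01. (\<forall>x\<in>{0..1}. f x = g x) \<longrightarrow> (\<forall>x\<in>{0..1}. T f x = T g x))"

definition linear_C01 :: "((real \<Rightarrow> real) \<Rightarrow> (real \<Rightarrow> real)) \<Rightarrow> bool" where
  "linear_C01 T \<longleftrightarrow>
     operator_C01 T \<and>
     (\<forall>f\<in>C01. \<forall>g\<in>C01. \<forall>x\<in>{0..1}. T (\<lambda>t. f t + g t) x = T f x + T g x) \<and>
     (\<forall>c. \<forall>f\<in>C01. \<forall>x\<in>{0..1}. T (\<lambda>t. c * f t) x = c * T f x)"

definition positive_C01 :: "((real \<Rightarrow> real) \<Rightarrow> (real \<Rightarrow> real)) \<Rightarrow> bool" where
  "positive_C01 T \<longleftrightarrow>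
     (\<forall>f\<in>C01. (\<forall>x\<in>{0..1}. 0 \<le> f x) \<longrightarrow> (\<forall>x\<in>{0..1}. 0 \<le> T f x))"

text \<open>\<^const>\<open>Sup\<close> of the empty set of reals is unspecified in HOL; here it is fixed to be 0.\<close>

definition Sup0 :: "real set \<Rightarrow> real" where
  "Sup0 A = (if A = {} then 0 else Sup A)"

definition omega2 :: "(real \<Rightarrow> real) \<Rightarrow> real \<Rightarrow> real" where
  "omega2 f t =
     Sup0 ((\<lambda>h. Sup0 ((\<lambda>x. \<bar>f (x + 2 * h) - 2 * f (x + h) + f x\<bar>) ` {0..1 - 2 * h})) ` {0<..t})"

definition lambda_m :: "((real \<Rightarrow> real) \<Rightarrow> (real \<Rightarrow> real)) \<Rightarrow> nat \<Rightarrow> real \<Rightarrow> real" where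
  "lambda_m T m x = max ((T ^^ m) (e 1) x) ((T ^^ m) (e 2) x)"

definition delta_m :: "((real \<Rightarrow> real) \<Rightarrow> (real \<Rightarrow> real)) \<Rightarrow> nat \<Rightarrow> real \<Rightarrow> real" where
  "delta_m T m x = (T ^^ m) (e 1) x"

end

theory Submission
  imports Defs
begin

text \<open>
  For fixed \<open>m\<close> and \<open>x\<close> the map \<open>f \<mapsto> T\<^sup>m(f;x)\<close> is a positive linear functional with
  total mass 1, so an estimate \<open>\<bar>f y - f 0\<bar> \<le> A + B * y\<close> on \<open>[0,1]\<close> integrates to
  \<open>\<bar>T\<^sup>m(f;x) - f 0\<bar> \<le> A + B * \<delta>\<^sub>m(x)\<close> (lemma \<open>positive_functional_deviation\<close>). It
  therefore suffices to find such an estimate whose coefficients are governed by the second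
  modulus of smoothness and the norm of \<open>f\<close>.

  Write \<open>\<omega> = \<omega>\<^sub>2(f,t)\<close>. From
  \<open>f y - f 0 = (f (2 * y) - f 0) / 2 - (f (2 * y) - 2 * f y + f 0) / 2\<close>
  the deviation at \<open>y\<close> is at most half the deviation at \<open>2 * y\<close> plus half a second difference
  of step \<open>y\<close>. Second differences of step \<open>h\<close> are at most \<open>\<omega> * max 1 (4 * h\<^sup>2 / t\<^sup>2)\<close>, by
  repeated halving of the step (lemma \<open>second_difference_le\<close>). Doubling \<open>y\<close> until it exceeds
  \<open>1/2\<close>, the second differences add up geometrically to at most
  \<open>\<omega> * (1 + 2 * y / t\<^sup>2)\<close>, while the deviation at the last point, at most
  \<open>2 * \<parallel>f\<parallel>\<close>, has been halved often enough to contribute at most \<open>4 * \<parallel>f\<parallel> * y\<close> (lemma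
  \<open>deviation_at_zero_le\<close>). The choice \<open>t\<^sup>2 = \<lambda>\<^sub>m(x) \<ge> \<delta>\<^sub>m(x)\<close> makes
  \<open>1 + 2 * \<delta>\<^sub>m(x) / t\<^sup>2\<close> at most 3. If \<open>\<lambda>\<^sub>m(x) = 0\<close>, continuity of \<open>f\<close> at 0 takes
  the place of the modulus.
\<close>

section \<open>The supremum norm and the second modulus of smoothness\<close>

lemma abs_le_sup_norm:
  assumes "f \<in> C01" "x \<in> {0..1}"
  shows "\<bar>f x\<bar> \<le> sup_norm f"
proof -
  have "continuous_on {0..1} (\<lambda>x. \<bar>f x\<bar>)"
    using assms(1) by (auto simp: C01_def intro: continuous_intros)
  then obtain z where "\<forall>y\<in>{0..1}. \<bar>f y\<bar> \<le> \<bar>f z\<bar>"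
    using continuous_attains_sup[of "{0..1}" "\<lambda>x. \<bar>f x\<bar>"] by auto
  then have "bdd_above ((\<lambda>x. \<bar>f x\<bar>) ` {0..1})"
    by (intro bdd_aboveI2) auto
  then show ?thesis
    unfolding sup_norm_def using assms(2) by (intro cSUP_upper)
qed

lemma Sup0_upper: "a \<in> A \<Longrightarrow> bdd_above A \<Longrightarrow> a \<le> Sup0 A"
  by (auto simp: Sup0_def intro: cSup_upper)

lemma Sup0_least: "(\<And>a. a \<in> A \<Longrightarrow> a \<le> b) \<Longrightarrow> 0 \<le> b \<Longrightarrow> Sup0 A \<le> b"
  by (auto simp: Sup0_def intro: cSup_least)

lemma second_difference_le_omega2:
  assumes f: "f \<in> C01" and h: "0 < h" "h \<le> t" and x: "0 \<le> x" "x + 2 * h \<le> 1"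
  shows "\<bar>f (x + 2 * h) - 2 * f (x + h) + f x\<bar> \<le> omega2 f t"
proof -
  define D where "D = (\<lambda>h x. \<bar>f (x + 2 * h) - 2 * f (x + h) + f x\<bar>)"
  have D_le: "D h x \<le> 4 * sup_norm f" if "h > 0" "x \<in> {0..1 - 2 * h}" for h x
    using abs_le_sup_norm[OF f, of "x + 2 * h"] abs_le_sup_norm[OF f, of "x + h"]
      abs_le_sup_norm[OF f, of x] that
    by (auto simp: D_def)
  have "0 \<le> sup_norm f"
    using abs_le_sup_norm[OF f, of 0] by simp
  then have S_le: "Sup0 (D h ` {0..1 - 2 * h}) \<le> 4 * sup_norm f" if "h > 0" for h
    using D_le that by (intro Sup0_least) auto
  have "D h x \<le> Sup0 (D h ` {0..1 - 2 * h})"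
    using h x by (intro Sup0_upper[OF imageI] bdd_aboveI2[OF D_le]) auto
  also have "\<dots> \<le> Sup0 ((\<lambda>h. Sup0 (D h ` {0..1 - 2 * h})) ` {0<..t})"
    using h by (intro Sup0_upper[OF imageI] bdd_aboveI2[OF S_le]) auto
  finally show ?thesis
    by (simp add: omega2_def D_def)
qed

lemma omega2_nonneg:
  assumes "f \<in> C01" "0 \<le> t"
  shows "0 \<le> omega2 f t"
proof (cases "t = 0")
  case True
  then show ?thesis by (simp add: omega2_def Sup0_def)
next
  case False
  then have "\<bar>f (0 + 2 * min t (1/2)) - 2 * f (0 + min t (1/2)) + f 0\<bar> \<le> omega2 f t"
    using assms by (intro second_difference_le_omega2) auto
  then show ?thesis by linarith
qed

section \<open>A pointwise estimate by dyadic scaling\<close>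

text \<open>
  A second difference of step \<open>2 * s\<close> is a combination with weights 1, 2, 1 of second
  differences of step \<open>s\<close>, so halving the step costs a factor 4. Halving is only applied while the
  step exceeds \<open>t\<close>; this is what turns the accumulated factor into \<open>4 * h\<^sup>2 / t\<^sup>2\<close>.
\<close>

lemma second_difference_le:
  assumes f: "f \<in> C01" and t: "0 < t" and h: "0 < h"
    and x: "0 \<le> x" "x + 2 * h \<le> 1"
  shows "\<bar>f (x + 2 * h) - 2 * f (x + h) + f x\<bar> \<le> omega2 f t * max 1 (4 * h\<^sup>2 / t\<^sup>2)"
proof -
  note nonneg = omega2_nonneg[OF f less_imp_le[OF t]]
  have small: "\<bar>f (x + 2 * h) - 2 * f (x + h) + f x\<bar> \<le> omega2 f t * max 1 (4 * h\<^sup>2 / t\<^sup>2)"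
    if "0 < h" "h \<le> t" "0 \<le> x" "x + 2 * h \<le> 1" for h x
  proof -
    have "\<bar>f (x + 2 * h) - 2 * f (x + h) + f x\<bar> \<le> omega2 f t * 1"
      using second_difference_le_omega2[OF f that] by simp
    also have "\<dots> \<le> omega2 f t * max 1 (4 * h\<^sup>2 / t\<^sup>2)"
      using nonneg by (intro mult_left_mono) auto
    finally show ?thesis .
  qed
  have scaled: "h \<le> 2 ^ n * t \<Longrightarrow>
      \<bar>f (x + 2 * h) - 2 * f (x + h) + f x\<bar> \<le> omega2 f t * max 1 (4 * h\<^sup>2 / t\<^sup>2)"
    if "0 < h" "0 \<le> x" "x + 2 * h \<le> 1" for n h x
    using that
  proof (induction n arbitrary: h x)
    case 0
    then show ?case using small by simp
  next
    case (Suc n)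
    show ?case
    proof (cases "h \<le> t")
      case True
      then show ?thesis using small Suc.prems by simp
    next
      case False
      define s where "s = h / 2"
      define M where "M = omega2 f t * max 1 (4 * s\<^sup>2 / t\<^sup>2)"
      have s: "h = 2 * s" "0 < s" "s \<le> 2 ^ n * t"
        using Suc.prems by (auto simp: s_def)
      have IH: "\<bar>f (y + 2 * s) - 2 * f (y + s) + f y\<bar> \<le> M"
        if "0 \<le> y" "y + 2 * s \<le> 1" for y
        using Suc.IH[of s y] s that by (simp add: M_def)
      have "\<bar>f (x + 2 * s) - 2 * f (x + s) + f x\<bar> \<le> M"
        and "\<bar>f (x + s + 2 * s) - 2 * f (x + s + s) + f (x + s)\<bar> \<le> M"
        and "\<bar>f (x + 2 * s + 2 * s) - 2 * f (x + 2 * s + s) + f (x + 2 * s)\<bar> \<le> M"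
        using Suc.prems s by (intro IH; simp)+
      moreover have "x + s + 2 * s = x + 3 * s" "x + s + s = x + 2 * s"
        "x + 2 * s + 2 * s = x + 4 * s" "x + 2 * s + s = x + 3 * s"
        by simp_all
      ultimately have "\<bar>f (x + 4 * s) - 2 * f (x + 2 * s) + f x\<bar> \<le> 4 * M"
        by (simp only:)
      then have "\<bar>f (x + 2 * h) - 2 * f (x + h) + f x\<bar> \<le> 4 * M"
        by (simp add: s(1))
      also have "4 * M = omega2 f t * max 4 (4 * h\<^sup>2 / t\<^sup>2)"
        using max_mult_distrib_left[of 4 1 "4 * s\<^sup>2 / t\<^sup>2"]
        by (simp add: M_def s(1) power_mult_distrib mult.left_commute)
      also have "max 4 (4 * h\<^sup>2 / t\<^sup>2) = max 1 (4 * h\<^sup>2 / t\<^sup>2)"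
      proof -
        have "t\<^sup>2 \<le> h\<^sup>2" using False t by (intro power_mono) auto
        then have "4 \<le> 4 * h\<^sup>2 / t\<^sup>2" using t by (simp add: le_divide_eq)
        then show ?thesis by simp
      qed
      finally show ?thesis .
    qed
  qed
  obtain n where "h / t < 2 ^ n"
    using real_arch_pow[of 2 "h / t"] by auto
  then have "h \<le> 2 ^ n * t"
    using t by (simp add: divide_less_eq)
  then show ?thesis using scaled h x by blast
qed

text \<open>
  The induction runs over the number of doublings that bring \<open>y\<close> into \<open>(1/2, 1]\<close>. It proves
  the bound with \<open>2 * (y - y\<^sup>2) / t\<^sup>2\<close> in place of \<open>2 * y / t\<^sup>2\<close>: a bound linear in \<open>y\<close> is
  reproduced by the recursion without any slack, and the quadratic term provides the slack that
  absorbs the contribution \<open>4 * y\<^sup>2 / t\<^sup>2\<close> of the second difference.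
\<close>

lemma deviation_at_zero_le:
  assumes f: "f \<in> C01" and t: "0 < t" and y: "y \<in> {0..1}"
  shows "\<bar>f y - f 0\<bar> \<le> omega2 f t * (1 + 2 * y / t\<^sup>2) + 4 * sup_norm f * y"
proof -
  define w where "w = omega2 f t"
  define N where "N = sup_norm f"
  have w: "0 \<le> w"
    using omega2_nonneg[OF f] t by (simp add: w_def)
  have N: "0 \<le> N" "\<bar>f y\<bar> \<le> N" if "y \<in> {0..1}" for y
    using abs_le_sup_norm[OF f that] by (auto simp: N_def)
  have dyadic: "\<bar>f y - f 0\<bar> \<le> w * (1 + 2 * (y - y\<^sup>2) / t\<^sup>2) + 4 * N * y"
    if "0 < y" "y \<le> 1" "1/2 < 2 ^ n * y" for n y
    using that
  proof (induction n arbitrary: y)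
    case 0
    have "y\<^sup>2 \<le> y"
      using 0 by (simp add: power2_eq_square mult_le_cancel_left1)
    then have "0 \<le> w * (1 + 2 * (y - y\<^sup>2) / t\<^sup>2)"
      using w by (intro mult_nonneg_nonneg add_nonneg_nonneg divide_nonneg_nonneg) auto
    moreover have "\<bar>f y - f 0\<bar> \<le> 2 * N"
      using N(2)[of y] N(2)[of 0] 0 by auto
    moreover have "2 * N \<le> 4 * N * y"
      using mult_left_mono[of "1/2" y "4 * N"] N(1)[of 0] 0 by simp
    ultimately show ?case by linarith
  next
    case (Suc n)
    show ?case
    proof (cases "1/2 < y")
      case True
      then show ?thesis using Suc.IH[of y] Suc.prems
        by (smt (verit) mult_le_cancel_right1 one_le_power)
    next
      case False
      have "2 * \<bar>f y - f 0\<bar> \<le> \<bar>f (2 * y) - f 0\<bar> + \<bar>f (2 * y) - 2 * f y + f 0\<bar>"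
        by (simp add: abs_if)
      also have "\<bar>f (2 * y) - f 0\<bar> \<le> w * (1 + 2 * (2 * y - (2 * y)\<^sup>2) / t\<^sup>2) + 2 * (4 * N * y)"
        using Suc.IH[of "2 * y"] Suc.prems False by (simp add: mult.assoc mult.left_commute)
      also have "\<bar>f (2 * y) - 2 * f y + f 0\<bar> \<le> w * max 1 (4 * y\<^sup>2 / t\<^sup>2)"
        using second_difference_le[OF f t, of y 0] Suc.prems False by (simp add: w_def)
      also have "w * max 1 (4 * y\<^sup>2 / t\<^sup>2) \<le> w * (1 + 4 * y\<^sup>2 / t\<^sup>2)"
        using w by (intro mult_left_mono) auto
      also have "w * (1 + 2 * (2 * y - (2 * y)\<^sup>2) / t\<^sup>2) + 2 * (4 * N * y) + w * (1 + 4 * y\<^sup>2 / t\<^sup>2)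
          = 2 * (w * (1 + 2 * (y - y\<^sup>2) / t\<^sup>2) + 4 * N * y)"
        using t by (simp add: field_simps power2_eq_square)
      finally show ?thesis by simp
    qed
  qed
  show ?thesis
  proof (cases "y = 0")
    case True
    then show ?thesis using w by (simp add: w_def)
  next
    case False
    with y have y': "0 < y" "y \<le> 1" by auto
    obtain n where "1 / (2 * y) < 2 ^ n"
      using real_arch_pow[of 2 "1 / (2 * y)"] by auto
    then have "1/2 < 2 ^ n * y"
      using y' by (simp add: field_simps)
    from dyadic[OF y' this]
    have "\<bar>f y - f 0\<bar> \<le> w * (1 + 2 * (y - y\<^sup>2) / t\<^sup>2) + 4 * N * y" .
    also have "w * (1 + 2 * (y - y\<^sup>2) / t\<^sup>2) \<le> w * (1 + 2 * y / t\<^sup>2)"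
      using w by (intro mult_left_mono add_left_mono divide_right_mono) auto
    finally show ?thesis by (simp add: w_def N_def)
  qed
qed

section \<open>Iterates of positive operators\<close>

lemma C01_add: "f \<in> C01 \<Longrightarrow> g \<in> C01 \<Longrightarrow> (\<lambda>t. f t + g t) \<in> C01"
  by (simp add: C01_def continuous_on_add)

lemma C01_scale: "f \<in> C01 \<Longrightarrow> (\<lambda>t. c * f t) \<in> C01" for c :: real
  by (simp add: C01_def continuous_on_mult_left)

lemma e_in_C01: "e i \<in> C01"
  by (auto simp: C01_def e_def intro: continuous_intros)

lemma linear_C01D:
  assumes "linear_C01 T"
  shows linear_C01_closed: "f \<in> C01 \<Longrightarrow> T f \<in> C01"
    and linear_C01_cong: "f \<in> C01 \<Longrightarrow> g \<in> C01 \<Longrightarrow> (\<And>y. y \<in> {0..1} \<Longrightarrow> f y = g y)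
      \<Longrightarrow> x \<in> {0..1} \<Longrightarrow> T f x = T g x"
    and linear_C01_add: "f \<in> C01 \<Longrightarrow> g \<in> C01 \<Longrightarrow> x \<in> {0..1}
      \<Longrightarrow> T (\<lambda>t. f t + g t) x = T f x + T g x"
    and linear_C01_scale: "f \<in> C01 \<Longrightarrow> x \<in> {0..1} \<Longrightarrow> T (\<lambda>t. c * f t) x = c * T f x"
  using assms unfolding linear_C01_def operator_C01_def by blast+

text \<open>
  The equations of \<open>linear_C01\<close> only hold on \<open>[0,1]\<close>, so they cannot be substituted under the
  outer operator; each step passes through the fact that \<open>T\<close> respects equality on \<open>[0,1]\<close>.
\<close>

lemma linear_C01_funpow:
  assumes T: "linear_C01 T"
  shows "linear_C01 (T ^^ m)"
proof (induction m)
  case 0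
  then show ?case by (simp add: linear_C01_def operator_C01_def)
next
  case (Suc m)
  define S where "S = T ^^ m"
  have S: "linear_C01 S" using Suc by (simp add: S_def)
  have cong: "T (S f) x = T g x"
    if "f \<in> C01" "g \<in> C01" "\<And>y. y \<in> {0..1} \<Longrightarrow> S f y = g y" "x \<in> {0..1}" for f g x
    using linear_C01_cong[OF T linear_C01_closed[OF S that(1)] that(2,3,4)] .
  have add: "T (S (\<lambda>t. f t + g t)) x = T (S f) x + T (S g) x"
    if fg: "f \<in> C01" "g \<in> C01" and x: "x \<in> {0..1}" for f g x
    using cong[OF C01_add[OF fg] C01_add[OF fg[THEN linear_C01_closed[OF S]]]
        linear_C01_add[OF S fg] x]
      linear_C01_add[OF T fg[THEN linear_C01_closed[OF S]] x] by simp
  have scale: "T (S (\<lambda>t. c * f t)) x = c * T (S f) x"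
    if f: "f \<in> C01" and x: "x \<in> {0..1}" for c f x
    using cong[OF C01_scale[OF f] C01_scale[OF linear_C01_closed[OF S f]]
        linear_C01_scale[OF S f] x]
      linear_C01_scale[OF T linear_C01_closed[OF S f] x] by simp
  have respects: "T (S f) x = T (S g) x"
    if fg: "f \<in> C01" "g \<in> C01" and eq: "\<forall>y\<in>{0..1}. f y = g y" and x: "x \<in> {0..1}" for f g x
    using cong[OF fg(1) linear_C01_closed[OF S fg(2)] linear_C01_cong[OF S fg bspec[OF eq]] x] .
  have "linear_C01 (\<lambda>f. T (S f))"
    unfolding linear_C01_def operator_C01_def
    by (intro conjI ballI allI impI linear_C01_closed[OF T] linear_C01_closed[OF S])
      (assumption | rule add scale respects; assumption)+
  then show ?case by (simp add: S_def comp_def)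
qed

lemma funpow_in_C01: "linear_C01 T \<Longrightarrow> f \<in> C01 \<Longrightarrow> (T ^^ m) f \<in> C01"
  by (rule linear_C01_closed[OF linear_C01_funpow])

lemma positive_C01_funpow:
  assumes T: "linear_C01 T" "positive_C01 T"
  shows "positive_C01 (T ^^ m)"
proof (induction m)
  case 0
  then show ?case by (simp add: positive_C01_def)
next
  case (Suc m)
  then show ?case
    using T(2) funpow_in_C01[OF T(1), of _ m] by (simp add: positive_C01_def)
qed

lemma funpow_e0:
  assumes T: "linear_C01 T" and e0: "\<And>x. x \<in> {0..1} \<Longrightarrow> T (e 0) x = e 0 x"
  shows "x \<in> {0..1} \<Longrightarrow> (T ^^ m) (e 0) x = 1"
proof (induction m arbitrary: x)
  case 0
  then show ?case by (simp add: e_def)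
next
  case (Suc m)
  have "\<forall>y\<in>{0..1}. (T ^^ m) (e 0) y = e 0 y"
    using Suc.IH by (simp add: e_def)
  then have "T ((T ^^ m) (e 0)) x = T (e 0) x"
    using linear_C01_cong[OF T funpow_in_C01[OF T e_in_C01] e_in_C01] Suc.prems by blast
  then show ?case using e0 Suc.prems by (simp add: e_def)
qed

text \<open>
  Positivity is applied to the two functions \<open>A + B * y \<minusplus> (f y - f 0)\<close>; the hypothesis that \<open>S\<close>
  maps 1 to 1 at \<open>x\<close> is what makes the constants \<open>A\<close> and \<open>f 0\<close> come out unchanged.
\<close>

lemma positive_functional_deviation:
  assumes S: "linear_C01 S" "positive_C01 S" and x: "x \<in> {0..1}" and one: "S (e 0) x = 1"
    and f: "f \<in> C01" and bound: "\<And>y. y \<in> {0..1} \<Longrightarrow> \<bar>f y - f 0\<bar> \<le> A + B * y"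
  shows "\<bar>S f x - f 0\<bar> \<le> A + B * S (e 1) x"
proof -
  note closed = C01_add C01_scale e_in_C01 f
  have "S (\<lambda>t. a * e 0 t + (b * e 1 t + c * f t)) x = a + (b * S (e 1) x + c * S f x)"
    for a b c
    using x one by (simp add: linear_C01_add[OF S(1)] linear_C01_scale[OF S(1)] closed)
  moreover have "0 \<le> S (\<lambda>t. a * e 0 t + (b * e 1 t + c * f t)) x"
    if "\<And>y. y \<in> {0..1} \<Longrightarrow> 0 \<le> a + (b * y + c * f y)" for a b c
  proof -
    have "(\<lambda>t. a * e 0 t + (b * e 1 t + c * f t)) \<in> C01"
      by (intro closed)
    then show ?thesis
      using S(2) x that by (simp add: positive_C01_def e_def)
  qed
  ultimately have eval: "0 \<le> a + (b * S (e 1) x + c * S f x)"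
    if "\<And>y. y \<in> {0..1} \<Longrightarrow> 0 \<le> a + (b * y + c * f y)" for a b c
    using that by metis
  have "0 \<le> (A + f 0) + (B * S (e 1) x + (- 1) * S f x)"
    by (intro eval) (use bound in \<open>fastforce simp: abs_le_iff\<close>)
  moreover have "0 \<le> (A - f 0) + (B * S (e 1) x + 1 * S f x)"
    by (intro eval) (use bound in \<open>fastforce simp: abs_le_iff\<close>)
  ultimately show ?thesis by (simp add: abs_le_iff)
qed

text \<open>
  A functional of mass 1 whose first moment vanishes is evaluation at 0: continuity at 0 and
  boundedness give \<open>\<bar>f y - f 0\<bar> \<le> \<epsilon> + (2 * \<parallel>f\<parallel> / \<eta>) * y\<close>, and the linear term has
  integral 0.
\<close>

lemma positive_functional_moment_zero:
  assumes S: "linear_C01 S" "positive_C01 S" and x: "x \<in> {0..1}" and one: "S (e 0) x = 1"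
    and moment: "S (e 1) x = 0" and f: "f \<in> C01"
  shows "S f x = f 0"
proof -
  have "\<bar>S f x - f 0\<bar> \<le> \<epsilon>" if \<epsilon>: "0 < \<epsilon>" for \<epsilon>
  proof -
    have "(f \<longlongrightarrow> f 0) (at 0 within {0..1})"
      using f by (simp add: C01_def continuous_on_def)
    then have "\<forall>\<^sub>F y in at 0 within {0..1}. dist (f y) (f 0) < \<epsilon>"
      using \<epsilon> by (rule tendstoD)
    then obtain \<eta> where "0 < \<eta>"
      and "\<forall>y\<in>{0..1}. y \<noteq> 0 \<and> dist y 0 < \<eta> \<longrightarrow> dist (f y) (f 0) < \<epsilon>"
      by (auto simp: eventually_at)
    then have \<eta>: "0 < \<eta>" "\<And>y. y \<in> {0..1} \<Longrightarrow> \<bar>y\<bar> < \<eta> \<Longrightarrow> \<bar>f y - f 0\<bar> < \<epsilon>"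
      using \<epsilon> by (auto simp: dist_real_def) (metis abs_zero atLeastAtMost_iff diff_self)
    have "\<bar>f y - f 0\<bar> \<le> \<epsilon> + 2 * sup_norm f / \<eta> * y" if y: "y \<in> {0..1}" for y
    proof (cases "y < \<eta>")
      case True
      moreover have "0 \<le> 2 * sup_norm f / \<eta> * y"
        using y \<eta>(1) abs_le_sup_norm[OF f y] by auto
      ultimately show ?thesis using \<eta>(2)[OF y] y by auto
    next
      case False
      have "\<bar>f y - f 0\<bar> \<le> 2 * sup_norm f * 1"
        using abs_le_sup_norm[OF f y] abs_le_sup_norm[OF f, of 0] by auto
      also have "\<dots> \<le> 2 * sup_norm f * (y / \<eta>)"
        using False \<eta>(1) abs_le_sup_norm[OF f y] by (intro mult_left_mono) auto
      finally show ?thesis using \<epsilon> by simp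
    qed
    from positive_functional_deviation[OF S x one f this] show ?thesis
      using moment by simp
  qed
  then have "\<bar>S f x - f 0\<bar> \<le> 0"
    by (rule field_le_epsilon) simp
  then show ?thesis by simp
qed

text \<open>
  The scale \<open>t = sqrt \<rho>\<close> balances the pointwise estimate: the term \<open>2 * y / t\<^sup>2\<close> integrates
  to \<open>2 * S (e 1) x / \<rho> \<le> 2\<close>, so the modulus enters with the constant \<open>1 + 2\<close>.
\<close>

lemma positive_functional_omega2:
  assumes S: "linear_C01 S" "positive_C01 S" and x: "x \<in> {0..1}" and one: "S (e 0) x = 1"
    and \<rho>: "S (e 1) x \<le> \<rho>" and f: "f \<in> C01"
  shows "\<bar>S f x - f 0\<bar> \<le> 3 * omega2 f (sqrt \<rho>) + 4 * sup_norm f * S (e 1) x"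
proof -
  define \<delta> where "\<delta> = S (e 1) x"
  have \<delta>: "0 \<le> \<delta>" "\<delta> \<le> \<rho>"
    using S(2) x \<rho> e_in_C01[of 1] by (auto simp: \<delta>_def positive_C01_def e_def)
  show ?thesis
  proof (cases "\<rho> = 0")
    case True
    then have "S (e 1) x = 0" using \<delta> by (simp add: \<delta>_def)
    then show ?thesis
      using positive_functional_moment_zero[OF S x one _ f] omega2_nonneg[OF f, of "sqrt \<rho>"] True
      by simp
  next
    case False
    then have pos: "0 < \<rho>" using \<delta> by simp
    define w where "w = omega2 f (sqrt \<rho>)"
    have w: "0 \<le> w" using omega2_nonneg[OF f] pos by (simp add: w_def)
    have "\<bar>f y - f 0\<bar> \<le> w + (2 * w / \<rho> + 4 * sup_norm f) * y" if "y \<in> {0..1}" for y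
      using deviation_at_zero_le[OF f _ that, of "sqrt \<rho>"] pos
      by (simp add: w_def algebra_simps)
    from positive_functional_deviation[OF S x one f this]
    have "\<bar>S f x - f 0\<bar> \<le> w + 2 * w * (\<delta> / \<rho>) + 4 * sup_norm f * \<delta>"
      by (simp add: \<delta>_def algebra_simps)
    also have "2 * w * (\<delta> / \<rho>) \<le> 2 * w * 1"
      using w pos \<delta> by (intro mult_left_mono) auto
    finally show ?thesis by (simp add: w_def \<delta>_def)
  qed
qed

theorem theorem6:
  shows "\<exists>k::real. k > 0 \<and>
    (\<forall>T :: (real \<Rightarrow> real) \<Rightarrow> (real \<Rightarrow> real).
       linear_C01 T \<longrightarrow> positive_C01 T \<longrightarrow>
       (\<forall>x\<in>{0..1}. T (e 0) x = e 0 x) \<longrightarrow>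
       (\<forall>x\<in>{0..1}. T (e 1) x \<le> x) \<longrightarrow>
       (\<lambda>m. sup_norm ((T ^^ m) (e 1))) \<longlonglongrightarrow> 0 \<longrightarrow>
       (\<lambda>m. sup_norm ((T ^^ m) (e 2))) \<longlonglongrightarrow> 0 \<longrightarrow>
       (\<forall>m::nat. \<forall>x\<in>{0..1}. \<forall>f\<in>C01.
          \<bar>(T ^^ m) f x - f 0\<bar>
            \<le> k * omega2 f (sqrt (lambda_m T m x)) + k * sup_norm f * delta_m T m x))"
proof (intro exI[of _ 4] conjI allI impI ballI)
  show "(0::real) < 4" by simp
next
  fix T :: "(real \<Rightarrow> real) \<Rightarrow> real \<Rightarrow> real" and m :: nat and x :: real and f :: "real \<Rightarrow> real"
  assume T: "linear_C01 T" "positive_C01 T" "\<forall>x\<in>{0..1}. T (e 0) x = e 0 x"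
    and x: "x \<in> {0..1}" and f: "f \<in> C01"
  have "\<bar>(T ^^ m) f x - f 0\<bar>
      \<le> 3 * omega2 f (sqrt (lambda_m T m x)) + 4 * sup_norm f * (T ^^ m) (e 1) x"
    using T(3)
    by (intro positive_functional_omega2[OF linear_C01_funpow[OF T(1)]
        positive_C01_funpow[OF T(1,2)] x funpow_e0[OF T(1) _ x] _ f])
      (simp_all add: lambda_m_def)
  moreover have "0 \<le> (T ^^ m) (e 1) x"
    using positive_C01_funpow[OF T(1,2)] x e_in_C01[of 1] by (simp add: positive_C01_def e_def)
  then have "0 \<le> omega2 f (sqrt (lambda_m T m x))"
    using f by (intro omega2_nonneg) (auto simp: lambda_m_def)
  ultimately show "\<bar>(T ^^ m) f x - f 0\<bar>
      \<le> 4 * omega2 f (sqrt (lambda_m T m x)) + 4 * sup_norm f * delta_m T m x"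
    by (simp add: delta_m_def)
qed

end
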